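(* Let $r\ge 3$ and $t\ge 3$, and suppose that $t-1$ is a prime power. Then \[ \gamma_{r-1}^+(\mathcal D_{r,t+1})\ge \frac{(t-1)^r-(t-1)^{r-1}}{(t-1)^r-1}=1-\frac1t-\frac1{t^2}+O(t^{-3}). \]
   Context: An $r$-graph is a collection of $r$-element subsets (edges) of a finite vertex set. For an $r$-graph $\mathcal H$ and an $(r-1)$-set $S$ of vertices, $d_{\mathcal H}(S)$ is the number of edges containing $S$. For a nonempty $r$-graph $\mathcal H$, the positive $(r-1)$-codegree is $\delta_{r-1}^+(\mathcal H)=\min\{d_{\mathcal H}(S): S\in\binom{V(\mathcal H)}{r-1},\ d_{\mathcal H}(S)>0\}$. For an $r$-graph $F$, $\operatorname{co\text{-}ex}_{r-1}^+(n,F)$ is the maximum of $\delta_{r-1}^+(\mathcal H)$ over all $F$-free (containing no copy of $F$ as a subgraph) $r$-graphs $\mathcal H$ on $n$ vertices, and $\gamma_{r-1}^+(F)=\lim_{n\to\infty}\operatorname{co\text{-}ex}_{r-1}^+(n,F)/n$ (this limit exists). The $(r,t)$-daisy $\mathcal D_{r,t}$ is the $r$-graph obtained from the complete graph $K_t$ by adding a fixed set of $r-2$ new vertices to each of its edges. The $O(t^{-3})$ refers to $t\to\infty$ with $r$ fixed. *)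

theory Defs
  imports Complex_Main "HOL-Library.Ramsey" "HOL-Library.Landau_Symbols"
    "HOL-Number_Theory.Prime_Powers"
begin

text \<open>A hypergraph is a pair of a vertex set and an edge set; isolated vertices are allowed.\<close>

type_synonym 'a hypergraph = "'a set \<times> 'a set set"

abbreviation verts :: "'a hypergraph \<Rightarrow> 'a set" where
  "verts H \<equiv> fst H"

abbreviation edges :: "'a hypergraph \<Rightarrow> 'a set set" where
  "edges H \<equiv> snd H"

definition r_graph :: "nat \<Rightarrow> 'a hypergraph \<Rightarrow> bool" where
  "r_graph r H \<longleftrightarrow> finite (verts H) \<and> edges H \<subseteq> nsets (verts H) r"

definition codegree :: "'a hypergraph \<Rightarrow> 'a set \<Rightarrow> nat" where
  "codegree H S = card {e \<in> edges H. S \<subseteq> e}"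

definition pos_codegree :: "nat \<Rightarrow> 'a hypergraph \<Rightarrow> nat" where
  "pos_codegree r H =
     Min {codegree H S |S. S \<in> nsets (verts H) (r - 1) \<and> codegree H S > 0}"

definition contains_copy :: "'a hypergraph \<Rightarrow> 'b hypergraph \<Rightarrow> bool" where
  "contains_copy H F \<longleftrightarrow>
     (\<exists>f. inj_on f (verts F) \<and> f ` verts F \<subseteq> verts H \<and> (\<forall>e\<in>edges F. f ` e \<in> edges H))"

text \<open>Every finite hypergraph is isomorphic to one whose vertices are natural numbers. For
  \<open>n < r\<close> there is no nonempty \<open>r\<close>-graph on \<open>n\<close> vertices and the value is that of
  \<^term>\<open>Max {}\<close>; this does not affect the limit below.\<close>

definition co_ex_pos :: "nat \<Rightarrow> nat \<Rightarrow> 'b hypergraph \<Rightarrow> nat" where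
  "co_ex_pos r n F =
     Max {pos_codegree r H |H :: nat hypergraph.
            r_graph r H \<and> card (verts H) = n \<and> edges H \<noteq> {} \<and> \<not> contains_copy H F}"

definition gamma_pos :: "nat \<Rightarrow> 'b hypergraph \<Rightarrow> real" where
  "gamma_pos r F = lim (\<lambda>n. real (co_ex_pos r n F) / real n)"

text \<open>The fixed \<open>r - 2\<close> vertices are \<open>0, \<dots>, r - 3\<close>, and the complete graph lives on the
  following \<open>t\<close> numbers. Meaningful for \<open>r \<ge> 2\<close>.\<close>

definition daisy :: "nat \<Rightarrow> nat \<Rightarrow> nat hypergraph" where
  "daisy r t =
     ({..<r - 2 + t}, {{..<r - 2} \<union> e |e. e \<in> nsets {r - 2..<r - 2 + t} 2})"

end

theory Submission
  imports Defs "HOL-Algebra.Algebraic_Closure" "HOL-Number_Theory.Residues"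
begin

text \<open>
  Any two vertices of a daisy lie in a common edge, so blowing up a daisy-free hypergraph keeps it
  daisy-free, while the positive codegree is multiplied by the blow-up factor. Hence the extremal
  function is superadditive up to rounding: the limit defining \<open>\<gamma>\<^sup>+\<close> exists and is at least
  \<open>\<delta>\<^sup>+(H) / |V(H)|\<close> for every single daisy-free \<open>H\<close>.

  For \<open>q = t - 1\<close> let the vertices of \<open>H\<close> be the nonzero vectors of an \<open>r\<close>-dimensional space over the
  field with \<open>q\<close> elements, and its edges the bases. An independent \<open>(r - 1)\<close>-set spans a hyperplane,
  hence has codegree \<open>q^r - q^(r-1)\<close>. The field with \<open>q^r\<close> elements serves as the space; it and its
  subfield with \<open>q\<close> elements are the solutions of \<open>x^(q^r) = x\<close> and \<open>x^q = x\<close> in an algebraic closure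
  of the prime field.
\<close>

section \<open>Positive codegree and blow-ups\<close>

text \<open>An edge over an \<open>(r - 1)\<close>-set is that set plus one vertex. Counting
  vertices instead of edges is what carries over to clones and to vectors.\<close>

lemma codegree_eq_card_extensions:
  assumes H: "r_graph r H" and S: "finite S" "card S = r - 1" and r: "r \<ge> 1"
  shows "codegree H S = card {x \<in> verts H - S. insert x S \<in> edges H}"
proof -
  have "{e \<in> edges H. S \<subseteq> e} = (\<lambda>x. insert x S) ` {x \<in> verts H - S. insert x S \<in> edges H}"
  proof (intro equalityI subsetI)
    fix e assume "e \<in> {e \<in> edges H. S \<subseteq> e}"
    then have e: "e \<in> edges H" "S \<subseteq> e" "e \<subseteq> verts H" "finite e" "card e = r"
      using H by (auto simp: r_graph_def nsets_def)
    then have "card (e - S) = 1"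
      using S r by (simp add: card_Diff_subset)
    then obtain x where x: "e - S = {x}"
      by (meson card_1_singletonE)
    then have "e = insert x S" "x \<in> verts H - S"
      using e by auto
    then show "e \<in> (\<lambda>x. insert x S) ` {x \<in> verts H - S. insert x S \<in> edges H}"
      using e by blast
  qed auto
  moreover have "inj_on (\<lambda>x. insert x S) {x \<in> verts H - S. insert x S \<in> edges H}"
    by (auto simp: inj_on_def)
  ultimately show ?thesis
    by (simp add: codegree_def card_image)
qed

lemma codegree_pos_iff:
  assumes "r_graph r H"
  shows "codegree H S > 0 \<longleftrightarrow> (\<exists>e\<in>edges H. S \<subseteq> e)"
proof -
  have "finite (edges H)"
    using assms by (meson r_graph_def finite_imp_finite_nsets finite_subset)
  then show ?thesis
    by (auto simp: codegree_def card_gt_0_iff)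
qed

text \<open>This makes the \<open>Min\<close> in \<open>pos_codegree\<close> meaningful: an edge
  with one vertex removed has positive codegree, and codegrees count vertices.\<close>

lemma pos_codegree_set:
  assumes H: "r_graph r H" and E: "edges H \<noteq> {}" and r: "r \<ge> 1"
  defines "A \<equiv> {codegree H S |S. S \<in> nsets (verts H) (r - 1) \<and> codegree H S > 0}"
  shows "finite A" "A \<noteq> {}" "\<And>m. m \<in> A \<Longrightarrow> m \<le> card (verts H)"
proof -
  have fin: "finite (verts H)"
    using H by (simp add: r_graph_def)
  have "A \<subseteq> codegree H ` nsets (verts H) (r - 1)"
    by (auto simp: A_def)
  then show "finite A"
    using fin by (meson finite_imp_finite_nsets finite_surj)
  obtain e where e: "e \<in> edges H"
    using E by blast
  then have "e \<subseteq> verts H" "finite e" "card e = r"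
    using H by (auto simp: r_graph_def nsets_def)
  moreover from this r obtain x where "x \<in> e"
    by (metis card.empty equals0I not_one_le_zero)
  ultimately have "e - {x} \<in> nsets (verts H) (r - 1)" "codegree H (e - {x}) > 0"
    using e codegree_pos_iff[OF H] by (auto simp: nsets_def)
  then show "A \<noteq> {}"
    by (auto simp: A_def)
  show "m \<le> card (verts H)" if m: "m \<in> A" for m
  proof -
    obtain S where "m = codegree H S" "finite S" "card S = r - 1"
      using m by (auto simp: A_def nsets_def)
    then show ?thesis
      using codegree_eq_card_extensions[OF H _ _ r] fin by (auto intro!: card_mono)
  qed
qed

lemma pos_codegree_geI:
  assumes "r_graph r H" "edges H \<noteq> {}" "r \<ge> 1"
    and "\<And>S. S \<in> nsets (verts H) (r - 1) \<Longrightarrow> codegree H S > 0 \<Longrightarrow> d \<le> codegree H S"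
  shows "d \<le> pos_codegree r H"
  unfolding pos_codegree_def
  using assms(4) by (intro Min.boundedI pos_codegree_set[OF assms(1-3)]) auto

lemma pos_codegree_le_codegree:
  assumes "r_graph r H" "edges H \<noteq> {}" "r \<ge> 1"
    and "S \<in> nsets (verts H) (r - 1)" "codegree H S > 0"
  shows "pos_codegree r H \<le> codegree H S"
  unfolding pos_codegree_def
  using assms(4,5) by (intro Min_le pos_codegree_set[OF assms(1-3)]) auto

lemma pos_codegree_le_card:
  assumes "r_graph r H" "edges H \<noteq> {}" "r \<ge> 1"
  shows "pos_codegree r H \<le> card (verts H)"
  unfolding pos_codegree_def
  by (intro pos_codegree_set[OF assms] Min_in)

text \<open>Infinitely many graphs may compete, as the vertices can be any \<open>n\<close>
  naturals, but their values are bounded by \<open>n\<close>.\<close>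

lemma finite_co_ex_pos_set:
  assumes "r \<ge> 1"
  shows "finite {pos_codegree r H |H :: nat hypergraph.
           r_graph r H \<and> card (verts H) = n \<and> edges H \<noteq> {} \<and> \<not> contains_copy H F}"
    (is "finite ?A")
proof (rule finite_subset)
  show "?A \<subseteq> {..n}"
    using pos_codegree_le_card[OF _ _ assms] by blast
qed simp

lemma co_ex_pos_ge:
  fixes H :: "nat hypergraph"
  assumes "r \<ge> 1" "r_graph r H" "card (verts H) = n" "edges H \<noteq> {}" "\<not> contains_copy H F"
  shows "pos_codegree r H \<le> co_ex_pos r n F"
  unfolding co_ex_pos_def using assms by (intro Max_ge finite_co_ex_pos_set) blast+

text \<open>The given \<open>H\<close> witnesses that the maximum is over a nonempty set, so it is
  not the unspecified \<open>Max {}\<close>.\<close>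

lemma co_ex_pos_attained:
  fixes H :: "nat hypergraph"
  assumes "r \<ge> 1" "r_graph r H" "card (verts H) = n" "edges H \<noteq> {}" "\<not> contains_copy H F"
  obtains G :: "nat hypergraph" where "r_graph r G" "card (verts G) = n" "edges G \<noteq> {}"
    "\<not> contains_copy G F" "co_ex_pos r n F = pos_codegree r G"
proof -
  have "co_ex_pos r n F \<in> {pos_codegree r H |H :: nat hypergraph.
          r_graph r H \<and> card (verts H) = n \<and> edges H \<noteq> {} \<and> \<not> contains_copy H F}"
    unfolding co_ex_pos_def using assms by (intro Max_in finite_co_ex_pos_set) blast+
  then show thesis
    using that by blast
qed

text \<open>Vertex \<open>i\<close> of the blow-up is a clone of \<open>h (i mod n)\<close>, so every vertex of \<open>H\<close> has at least
  \<open>N div n\<close> clones. As any two vertices of \<open>F\<close> lie in a common edge, a copy of \<open>F\<close> in the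
  blow-up uses at most one clone of each vertex and projects to a copy in \<open>H\<close>.\<close>

lemma blow_up:
  fixes H :: "'a hypergraph"
  assumes H: "r_graph r H" "edges H \<noteq> {}" "\<not> contains_copy H F" and r: "r \<ge> 1"
    and F: "\<And>x y. x \<in> verts F \<Longrightarrow> y \<in> verts F \<Longrightarrow> x \<noteq> y \<Longrightarrow> \<exists>e\<in>edges F. x \<in> e \<and> y \<in> e"
      "\<And>e. e \<in> edges F \<Longrightarrow> e \<subseteq> verts F"
    and d: "\<And>S. S \<in> nsets (verts H) (r - 1) \<Longrightarrow> codegree H S > 0 \<Longrightarrow> d \<le> codegree H S"
    and n: "card (verts H) = n" and N: "n \<le> N"
  obtains G :: "nat hypergraph" where "r_graph r G" "card (verts G) = N" "edges G \<noteq> {}"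
    "\<not> contains_copy G F" "(N div n) * d \<le> pos_codegree r G"
proof -
  have fin: "finite (verts H)"
    using H by (simp add: r_graph_def)
  then obtain h where h: "bij_betw h {..<n} (verts H)"
    using n ex_bij_betw_nat_finite[of "verts H"] by (auto simp: atLeast0LessThan)
  obtain e where e: "e \<in> edges H"
    using H by blast
  then have e': "e \<subseteq> verts H" "finite e" "card e = r"
    using H by (auto simp: r_graph_def nsets_def)
  have n0: "n > 0"
    using e' r fin n by (metis One_nat_def card_gt_0_iff card_mono le_zero_eq not_gr0 not_less_eq_eq)
  define \<pi> where "\<pi> i = h (i mod n)" for i
  have \<pi>V: "\<pi> i \<in> verts H" for i
    using h n0 by (auto simp: \<pi>_def bij_betw_def)
  \<comment> \<open>Injectivity of \<pi> on edges keeps two clones of one vertex out of a common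
    edge.\<close>
  define E where "E = {e \<in> nsets {..<N} r. inj_on \<pi> e \<and> \<pi> ` e \<in> edges H}"
  define G where "G = ({..<N}, E)"
  have G: "r_graph r G"
    by (auto simp: r_graph_def G_def E_def)
  have EG: "edges G \<noteq> {}"
  proof -
    \<comment> \<open>Indices below \<open>n\<close> form one copy of \<open>H\<close>: there \<pi>
      agrees with \<open>h\<close>, and \<open>n \<le> N\<close> keeps them inside the vertex
      set.\<close>
    let ?e = "{i \<in> {..<n}. h i \<in> e}"
    have "h ` ?e = e"
      using h e' by (auto simp: bij_betw_def)
    moreover have "inj_on h ?e"
      using h by (auto simp: bij_betw_def inj_on_def)
    moreover have "\<pi> i = h i" if "i \<in> ?e" for i
      using that by (simp add: \<pi>_def)
    ultimately have "inj_on \<pi> ?e" "\<pi> ` ?e = e" "card ?e = r"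
      using e' card_image[of h ?e] by (auto simp: inj_on_def)
    then have "?e \<in> E"
      using e N by (auto simp: E_def nsets_def)
    then show ?thesis
      by (auto simp: G_def)
  qed
  have free: "\<not> contains_copy G F"
  proof
    assume "contains_copy G F"
    then obtain f where f: "inj_on f (verts F)" "f ` verts F \<subseteq> {..<N}"
      "\<And>e. e \<in> edges F \<Longrightarrow> f ` e \<in> E"
      by (auto simp: contains_copy_def G_def)
    have "inj_on (\<pi> \<circ> f) (verts F)"
    proof (rule inj_onI, rule ccontr)
      fix x y assume xy: "x \<in> verts F" "y \<in> verts F" "(\<pi> \<circ> f) x = (\<pi> \<circ> f) y" "x \<noteq> y"
      then obtain e where e: "e \<in> edges F" "x \<in> e" "y \<in> e"
        using F by blast
      then have "inj_on \<pi> (f ` e)"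
        using f(3) by (auto simp: E_def)
      then have "f x = f y"
        using e xy by (auto dest: inj_onD)
      then show False
        using xy f(1) by (auto dest: inj_onD)
    qed
    moreover have "(\<pi> \<circ> f) ` e \<in> edges H" if "e \<in> edges F" for e
      using f(3)[OF that] by (simp add: E_def image_comp)
    ultimately have "contains_copy H F"
      unfolding contains_copy_def using \<pi>V by (intro exI[of _ "\<pi> \<circ> f"]) auto
    then show False
      using H by blast
  qed
  have fibre: "N div n \<le> card {i \<in> {..<N}. \<pi> i = x}" if x: "x \<in> verts H" for x
  proof -
    have "x \<in> h ` {..<n}"
      using x h by (simp add: bij_betw_def)
    then obtain j where j: "j < n" "h j = x"
      by blast
    \<comment> \<open>The clones of \<open>h j\<close> are the numbers congruent to \<open>j\<close>
      modulo \<open>n\<close>; each complete block of length \<open>n\<close> below \<open>N\<close>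
      contains one.\<close>
    have "(\<lambda>k. j + n * k) ` {..<N div n} \<subseteq> {i \<in> {..<N}. \<pi> i = x}"
    proof clarsimp
      fix k assume "k < N div n"
      then have "n * Suc k \<le> n * (N div n)"
        by (intro mult_le_mono2) simp
      also have "\<dots> \<le> N"
        by simp
      finally show "j + n * k < N \<and> \<pi> (j + n * k) = x"
        using j by (simp add: \<pi>_def)
    qed
    then have "card ((\<lambda>k. j + n * k) ` {..<N div n}) \<le> card {i \<in> {..<N}. \<pi> i = x}"
      by (intro card_mono) auto
    moreover have "inj_on (\<lambda>k. j + n * k) {..<N div n}"
      using n0 by (auto simp: inj_on_def)
    ultimately show ?thesis
      by (simp add: card_image)
  qed
  have "(N div n) * d \<le> pos_codegree r G"
  proof (rule pos_codegree_geI[OF G EG r])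
    fix S assume S: "S \<in> nsets (verts G) (r - 1)" and "codegree G S > 0"
    then obtain e where e: "e \<in> E" "S \<subseteq> e"
      using codegree_pos_iff[OF G] by (auto simp: G_def)
    have S': "S \<subseteq> {..<N}" "finite S" "card S = r - 1"
      using S by (auto simp: nsets_def G_def)
    have injS: "inj_on \<pi> S"
      using e by (auto simp: E_def intro: inj_on_subset)
    have \<pi>S: "\<pi> ` S \<in> nsets (verts H) (r - 1)"
      using S' \<pi>V injS by (auto simp: nsets_def card_image)
    have "codegree H (\<pi> ` S) > 0"
      using e codegree_pos_iff[OF H(1)] by (auto simp: E_def intro!: bexI[of _ "\<pi> ` e"])
    then have "d \<le> codegree H (\<pi> ` S)"
      using d \<pi>S by blast
    \<comment> \<open>Every clone of a vertex extending the projection of \<open>S\<close> extends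
      \<open>S\<close>, and the clone classes are disjoint, so the bound is multiplied by
      \<open>N div n\<close>.\<close>
    also define Y where "Y = {x \<in> verts H - \<pi> ` S. insert x (\<pi> ` S) \<in> edges H}"
    have "codegree H (\<pi> ` S) = card Y"
      unfolding Y_def using \<pi>S by (intro codegree_eq_card_extensions[OF H(1) _ _ r]) (auto simp: nsets_def)
    finally have "(N div n) * d \<le> (\<Sum>x\<in>Y. N div n)"
      by simp
    also have "\<dots> \<le> (\<Sum>x\<in>Y. card {i \<in> {..<N}. \<pi> i = x})"
      using fibre by (intro sum_mono) (auto simp: Y_def)
    also have "\<dots> = card (\<Union>x\<in>Y. {i \<in> {..<N}. \<pi> i = x})"
      using fin by (subst card_UN_disjoint) (auto simp: Y_def)
    also have "\<dots> \<le> card {i \<in> verts G - S. insert i S \<in> edges G}"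
    proof (intro card_mono)
      show "(\<Union>x\<in>Y. {i \<in> {..<N}. \<pi> i = x}) \<subseteq> {i \<in> verts G - S. insert i S \<in> edges G}"
      proof
        fix i assume "i \<in> (\<Union>x\<in>Y. {i \<in> {..<N}. \<pi> i = x})"
        then have i: "i \<in> {..<N}" "\<pi> i \<in> Y"
          by auto
        then have "\<pi> i \<notin> \<pi> ` S" "insert (\<pi> i) (\<pi> ` S) \<in> edges H"
          by (auto simp: Y_def)
        moreover from this have "i \<notin> S"
          by blast
        ultimately show "i \<in> {i \<in> verts G - S. insert i S \<in> edges G}"
          using S' injS r i by (simp add: G_def E_def nsets_def)
      qed
    qed (auto simp: G_def)
    also have "\<dots> = codegree G S"
      using codegree_eq_card_extensions[OF G _ _ r] S' by simp
    finally show "(N div n) * d \<le> codegree G S" .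
  qed
  with G EG free show thesis
    by (intro that[of G]) (auto simp: G_def)
qed

section \<open>Existence of the limit\<close>

text \<open>A Fekete-type argument: the limit is the supremum of the ratios from \<open>n0\<close>
  on. Rounding in \<open>N div n\<close> costs less than one factor \<open>a n\<close>, and this
  loss divided by \<open>N\<close> vanishes.\<close>

lemma superadditive_ratio_convergent:
  fixes a :: "nat \<Rightarrow> nat"
  assumes n0: "n0 > 0" and le: "\<And>n. n \<ge> n0 \<Longrightarrow> a n \<le> n"
    and sup: "\<And>n N. n0 \<le> n \<Longrightarrow> n \<le> N \<Longrightarrow> (N div n) * a n \<le> a N"
  obtains l where "(\<lambda>n. real (a n) / real n) \<longlonglongrightarrow> l" "\<And>n. n \<ge> n0 \<Longrightarrow> real (a n) / real n \<le> l"
proof -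
  let ?x = "\<lambda>n. real (a n) / real n"
  define l where "l = (SUP n\<in>{n0..}. ?x n)"
  have bdd: "bdd_above (?x ` {n0..})"
    using le n0 by (intro bdd_aboveI[of _ 1]) (auto simp: divide_le_eq)
  have upper: "?x n \<le> l" if "n \<ge> n0" for n
    unfolding l_def using that by (intro cSUP_upper bdd) auto
  have "?x \<longlonglongrightarrow> l"
  proof (rule order_tendstoI)
    fix u assume "l < u"
    then show "\<forall>\<^sub>F n in sequentially. ?x n < u"
      using upper by (intro eventually_sequentiallyI[of n0]) (meson le_less_trans)
  next
    fix u assume "u < l"
    then obtain n where n: "n \<ge> n0" "u < ?x n"
      unfolding l_def using less_cSUP_iff[OF _ bdd] by auto
    have "(\<lambda>N. ?x n - real (a n) * inverse (real N)) \<longlonglongrightarrow> ?x n - real (a n) * 0"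
      by (intro tendsto_intros lim_inverse_n)
    then have "\<forall>\<^sub>F N in sequentially. u < ?x n - real (a n) * inverse (real N)"
      using n by (intro order_tendstoD(1)) auto
    moreover have "\<forall>\<^sub>F N in sequentially. N \<ge> n"
      by (rule eventually_ge_at_top)
    ultimately show "\<forall>\<^sub>F N in sequentially. u < ?x N"
    proof eventually_elim
      case (elim N)
      have pos: "real n > 0" "real N > 0"
        using n0 n elim by auto
      \<comment> \<open>Division with remainder gives \<open>N div n \<ge> N / n - 1\<close>, hence
        the ratio at \<open>N\<close> is at least \<open>a n / n - a n / N\<close>.\<close>
      have "N \<le> n + n * (N div n)"
        using pos by (intro less_imp_le dividend_less_times_div) simp
      then have "real N \<le> real n + real n * real (N div n)"
        by (metis of_nat_add of_nat_le_iff of_nat_mult)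
      then have "real N / real n - 1 \<le> real (N div n)"
        using pos by (simp add: field_simps)
      then have "(real N / real n - 1) * real (a n) \<le> real (N div n) * real (a n)"
        by (intro mult_right_mono) auto
      also have "\<dots> \<le> real (a N)"
        using sup[OF n(1) elim(2)] by (metis of_nat_le_iff of_nat_mult)
      finally have "(real N / real n - 1) * real (a n) / real N \<le> ?x N"
        using pos by (intro divide_right_mono) auto
      moreover have "(real N / real n - 1) * real (a n) / real N = ?x n - real (a n) * inverse (real N)"
        using pos by (simp add: field_simps)
      ultimately show ?case
        using elim by linarith
    qed
  qed
  then show thesis
    using upper that by blast
qed

text \<open>Blow-ups of \<open>H\<close> make the competition nonempty for every
  \<open>n \<ge> n0\<close>; blow-ups of extremal graphs give superadditivity; the value at
  \<open>n0\<close> is at least \<open>d\<close>, and the limit dominates its ratio.\<close>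

lemma gamma_pos_ge:
  fixes H :: "'a hypergraph"
  assumes H: "r_graph r H" "edges H \<noteq> {}" "\<not> contains_copy H F" and r: "r \<ge> 1"
    and F: "\<And>x y. x \<in> verts F \<Longrightarrow> y \<in> verts F \<Longrightarrow> x \<noteq> y \<Longrightarrow> \<exists>e\<in>edges F. x \<in> e \<and> y \<in> e"
      "\<And>e. e \<in> edges F \<Longrightarrow> e \<subseteq> verts F"
    and d: "\<And>S. S \<in> nsets (verts H) (r - 1) \<Longrightarrow> codegree H S > 0 \<Longrightarrow> d \<le> codegree H S"
  shows "real d / real (card (verts H)) \<le> gamma_pos r F"
proof -
  define n0 where "n0 = card (verts H)"
  have "n0 > 0"
  proof -
    obtain e where "e \<in> edges H"
      using H by blast
    then have "e \<subseteq> verts H" "card e = r" "finite (verts H)"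
      using H by (auto simp: r_graph_def nsets_def)
    then show ?thesis
      using card_mono[of "verts H" e] r by (simp add: n0_def)
  qed
  have ex: "\<exists>G :: nat hypergraph. r_graph r G \<and> card (verts G) = n \<and> edges G \<noteq> {}
      \<and> \<not> contains_copy G F \<and> co_ex_pos r n F = pos_codegree r G" if n: "n \<ge> n0" for n
  proof -
    obtain G :: "nat hypergraph" where G: "r_graph r G" "card (verts G) = n" "edges G \<noteq> {}"
      "\<not> contains_copy G F"
      using blow_up[OF H r F d n0_def[symmetric] n] by blast
    show ?thesis
      by (rule co_ex_pos_attained[OF r G]) blast
  qed
  have le: "co_ex_pos r n F \<le> n" if n: "n \<ge> n0" for n
    using ex[OF n] pos_codegree_le_card r by metis
  have sup: "(N div n) * co_ex_pos r n F \<le> co_ex_pos r N F" if n: "n0 \<le> n" and N: "n \<le> N" for n N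
  proof -
    obtain G :: "nat hypergraph" where G: "r_graph r G" "card (verts G) = n" "edges G \<noteq> {}"
      "\<not> contains_copy G F" "co_ex_pos r n F = pos_codegree r G"
      using ex[OF n] by blast
    obtain G' :: "nat hypergraph" where G': "r_graph r G'" "card (verts G') = N" "edges G' \<noteq> {}"
      "\<not> contains_copy G' F" "(N div n) * pos_codegree r G \<le> pos_codegree r G'"
      using blow_up[OF G(1,3,4) r F pos_codegree_le_codegree[OF G(1,3) r] G(2) N] by blast
    then show ?thesis
      using co_ex_pos_ge[OF r G'(1-4)] G(5) by simp
  qed
  obtain l where l: "(\<lambda>n. real (co_ex_pos r n F) / real n) \<longlonglongrightarrow> l"
    "\<And>n. n \<ge> n0 \<Longrightarrow> real (co_ex_pos r n F) / real n \<le> l"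
    using superadditive_ratio_convergent[OF \<open>n0 > 0\<close> le sup] by blast
  \<comment> \<open>Blowing up by the factor \<open>n0 div n0 = 1\<close> merely relabels
    \<open>H\<close> by natural numbers.\<close>
  have "d \<le> co_ex_pos r n0 F"
  proof -
    obtain G :: "nat hypergraph" where G: "r_graph r G" "card (verts G) = n0" "edges G \<noteq> {}"
      "\<not> contains_copy G F" "(n0 div n0) * d \<le> pos_codegree r G"
      using blow_up[OF H r F d n0_def[symmetric] order_refl] by blast
    then show ?thesis
      using co_ex_pos_ge[OF r G(1-4)] \<open>n0 > 0\<close> by simp
  qed
  then have "real d / real n0 \<le> real (co_ex_pos r n0 F) / real n0"
    by (intro divide_right_mono) auto
  also have "\<dots> \<le> l"
    by (rule l) simp
  also have "l = gamma_pos r F"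
    unfolding gamma_pos_def using l(1) by (simp add: limI)
  finally show ?thesis
    by (simp add: n0_def)
qed

text \<open>This is the covering condition for blow-ups. The core lies in every edge, so it suffices
  to choose the pair \<open>u\<close>, \<open>v\<close> to include whichever of \<open>x\<close>,
  \<open>y\<close> are petals; \<open>t \<ge> 2\<close> supplies missing partners.\<close>

lemma daisy_pair_in_edge:
  assumes x: "x \<in> verts (daisy r t)" and y: "y \<in> verts (daisy r t)" and xy: "x \<noteq> y" and t: "t \<ge> 2"
  shows "\<exists>e\<in>edges (daisy r t). x \<in> e \<and> y \<in> e"
proof -
  define W where "W = {r - 2..<r - 2 + t}"
  have edge: "{..<r - 2} \<union> {u, v} \<in> edges (daisy r t)" if "u \<in> W" "v \<in> W" "u \<noteq> v" for u v
  proof -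
    have "{u, v} \<in> nsets W 2"
      using that by simp
    then show ?thesis
      unfolding daisy_def W_def snd_conv by blast
  qed
  have base: "r - 2 \<in> W" "Suc (r - 2) \<in> W"
    using t by (auto simp: W_def)
  then have other: "\<exists>v. v \<in> W \<and> u \<noteq> v" for u
    by (metis n_not_Suc_n)
  have cases: "z < r - 2 \<or> z \<in> W" if "z \<in> verts (daisy r t)" for z
    using that by (auto simp: daisy_def W_def)
  obtain u v where "u \<in> W" "v \<in> W" "u \<noteq> v" "x < r - 2 \<or> x \<in> {u, v}" "y < r - 2 \<or> y \<in> {u, v}"
    using cases[OF x] cases[OF y] xy other base(1) by (metis insertCI)
  then show ?thesis
    by (intro bexI[OF _ edge]) auto
qed

lemma daisy_edge_subset_verts: "e \<in> edges (daisy r t) \<Longrightarrow> e \<subseteq> verts (daisy r t)"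
  by (auto simp: daisy_def nsets_def)

section \<open>The hypergraph of bases of a finite vector space\<close>

text \<open>The linear algebra needed below is phrased through cardinalities of spans only: \<open>S\<close> is independent
  iff its span has \<open>q ^ card S\<close> elements.\<close>

locale counting_span =
  fixes V :: "'a set" and span :: "'a set \<Rightarrow> 'a set" and q r :: nat
  assumes q_ge_2: "q \<ge> 2" and finite_V: "finite V" and card_V: "card V = q ^ r"
    and span_subset: "S \<subseteq> V \<Longrightarrow> span S \<subseteq> V"
    and span_superset: "S \<subseteq> V \<Longrightarrow> S \<subseteq> span S"
    and span_minimal: "S \<subseteq> V \<Longrightarrow> T \<subseteq> V \<Longrightarrow> S \<subseteq> span T \<Longrightarrow> span S \<subseteq> span T"
    and card_span_empty: "card (span {}) = 1"
    and card_span_insert: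
      "S \<subseteq> V \<Longrightarrow> v \<in> V \<Longrightarrow> v \<notin> span S \<Longrightarrow> card (span (insert v S)) = q * card (span S)"
begin

definition indep :: "'a set \<Rightarrow> bool" where
  "indep S \<longleftrightarrow> card (span S) = q ^ card S"

text \<open>With \<open>card V = q ^ r\<close>, independent \<open>r\<close>-sets are bases. The set
  \<open>span {}\<close> holds only the zero vector; discarding it turns the vertex count into
  \<open>q ^ r - 1\<close>.\<close>

definition basis_graph :: "'a hypergraph" where
  "basis_graph = (V - span {}, {S \<in> nsets V r. indep S})"

section \<open>Independence by counting\<close>

lemma finite_span: "S \<subseteq> V \<Longrightarrow> finite (span S)"
  using finite_V finite_subset span_subset by blast

lemma span_mono: "S \<subseteq> T \<Longrightarrow> T \<subseteq> V \<Longrightarrow> span S \<subseteq> span T"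
  using span_minimal[of S T] span_superset[of T] by blast

lemma span_insert_absorb:
  assumes "S \<subseteq> V" "v \<in> span S"
  shows "span (insert v S) = span S"
proof
  have V: "insert v S \<subseteq> V"
    using assms span_subset by blast
  show "span S \<subseteq> span (insert v S)"
    using V by (rule span_mono[rotated]) blast
  have "insert v S \<subseteq> span S"
    using assms span_superset[OF assms(1)] by blast
  then show "span (insert v S) \<subseteq> span S"
    by (rule span_minimal[OF V assms(1)])
qed

lemma card_span_le:
  assumes "S \<subseteq> V"
  shows "card (span S) \<le> q ^ card S"
proof -
  have "finite S"
    using assms finite_V finite_subset by blast
  then show ?thesis using assms
  proof (induction S)
    case empty
    then show ?case by (simp add: card_span_empty)
  next
    case (insert v S)
    have "card (span (insert v S)) \<le> q * card (span S)"
    proof (cases "v \<in> span S")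
      case True
      then show ?thesis using insert.prems q_ge_2 by (simp add: span_insert_absorb)
    next
      case False
      then show ?thesis using insert.prems by (simp add: card_span_insert)
    qed
    also have "\<dots> \<le> q * q ^ card S"
      using insert by (intro mult_le_mono2) auto
    finally show ?case
      using insert.hyps by simp
  qed
qed

text \<open>If \<open>v\<close> is in the span, the span is too small for \<open>card S + 1\<close>
  vectors; otherwise its size grows by exactly the factor \<open>q\<close>, which cancels.\<close>

lemma indep_insert_iff:
  assumes S: "S \<subseteq> V" and v: "v \<in> V" "v \<notin> S"
  shows "indep (insert v S) \<longleftrightarrow> indep S \<and> v \<notin> span S"
proof -
  have card: "card (insert v S) = Suc (card S)"
    using assms finite_V finite_subset by (metis card_insert_disjoint)
  show ?thesis
  proof (cases "v \<in> span S")
    case True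
    have "card (span (insert v S)) \<le> q ^ card S"
      using card_span_le[OF S] span_insert_absorb[OF S True] by simp
    also have "\<dots> < q ^ card (insert v S)"
      using q_ge_2 by (simp add: card)
    finally show ?thesis
      using True by (simp add: indep_def)
  next
    case False
    then show ?thesis
      using q_ge_2 card_span_insert[OF S v(1) False] by (simp add: indep_def card)
  qed
qed

lemma indep_disjoint_span_empty:
  assumes S: "S \<subseteq> V" "indep S"
  shows "S \<inter> span {} = {}"
proof -
  have "x \<notin> span {}" if x: "x \<in> S" for x
  proof -
    have sub: "S - {x} \<subseteq> V" "x \<in> V" "x \<notin> S - {x}" "insert x (S - {x}) = S"
      using S x by auto
    then have "x \<notin> span (S - {x})"
      using indep_insert_iff[OF sub(1-3)] S by simp
    then show ?thesis
      using span_mono[of "{}" "S - {x}"] sub by blast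
  qed
  then show ?thesis by blast
qed

text \<open>Greedy choice: \<open>k < r\<close> independent vectors span only
  \<open>q ^ k < q ^ r\<close> elements, so some vector lies outside.\<close>

lemma exists_indep:
  assumes "k \<le> r"
  shows "\<exists>S\<subseteq>V. card S = k \<and> indep S"
  using assms
proof (induction k)
  case 0
  then show ?case by (intro exI[of _ "{}"]) (simp add: indep_def card_span_empty)
next
  case (Suc k)
  then obtain S where S: "S \<subseteq> V" "card S = k" "indep S"
    by auto
  have "card (span S) < card V"
    using S Suc.prems q_ge_2 by (simp add: indep_def card_V power_strict_increasing)
  then have "\<not> V \<subseteq> span S"
    using card_mono[OF finite_span[OF S(1)], of V] by linarith
  then obtain v where v: "v \<in> V" "v \<notin> span S"
    by blast
  then have "v \<notin> S"
    using span_superset[OF S(1)] by blast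
  moreover have "finite S"
    using S(1) finite_V finite_subset by blast
  ultimately have "card (insert v S) = Suc k" "indep (insert v S)" "insert v S \<subseteq> V"
    using S v indep_insert_iff[OF S(1) v(1)] by auto
  then show ?case
    by blast
qed

section \<open>Codegrees and daisy-freeness of the graph of bases\<close>

lemma r_graph_basis_graph: "r_graph r basis_graph"
  unfolding r_graph_def basis_graph_def
  using finite_V indep_disjoint_span_empty by (auto simp: nsets_def)

lemma edges_basis_graph_nonempty: "edges basis_graph \<noteq> {}"
proof -
  obtain S where "S \<subseteq> V" "card S = r" "indep S"
    using exists_indep by blast
  moreover from this have "finite S"
    using finite_V finite_subset by blast
  ultimately have "S \<in> edges basis_graph"
    by (simp add: basis_graph_def nsets_def)
  then show ?thesis by blast
qed

lemma span_empty_subset: "span {} \<subseteq> V"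
  by (rule span_subset) simp

lemma card_verts_basis_graph: "card (verts basis_graph) = q ^ r - 1"
  using card_Diff_subset[OF finite_span span_empty_subset]
  by (simp add: basis_graph_def card_V card_span_empty)

text \<open>Positive codegree means that \<open>S\<close> lies in a basis and is independent. Its
  extensions are then exactly the vectors outside a span of size \<open>q ^ (r - 1)\<close>.\<close>

lemma codegree_basis_graph:
  assumes r: "r \<ge> 1" and S: "S \<in> nsets (verts basis_graph) (r - 1)"
    and pos: "codegree basis_graph S > 0"
  shows "codegree basis_graph S = q ^ r - q ^ (r - 1)"
proof -
  have S': "S \<subseteq> V" "finite S" "card S = r - 1"
    using S by (auto simp: basis_graph_def nsets_def)
  have ext: "codegree basis_graph S = card {x \<in> verts basis_graph - S. insert x S \<in> edges basis_graph}"
    using codegree_eq_card_extensions[OF r_graph_basis_graph S'(2,3) r] .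
  obtain y where y: "y \<in> verts basis_graph - S" "insert y S \<in> edges basis_graph"
    using pos unfolding ext card_gt_0_iff by blast
  then have "y \<in> V" "y \<notin> S" "indep (insert y S)"
    by (auto simp: basis_graph_def)
  then have indep: "indep S"
    using indep_insert_iff[OF S'(1)] by blast
  have "{x \<in> verts basis_graph - S. insert x S \<in> edges basis_graph} = V - span S"
  proof (intro equalityI subsetI)
    fix x assume x: "x \<in> V - span S"
    then have "x \<notin> S" "x \<notin> span {}"
      using span_superset[OF S'(1)] span_mono[OF _ S'(1), of "{}"] by auto
    then show "x \<in> {x \<in> verts basis_graph - S. insert x S \<in> edges basis_graph}"
      using x S' r indep indep_insert_iff[OF S'(1)] by (simp add: basis_graph_def nsets_def)
  qed (use indep_insert_iff[OF S'(1)] in \<open>auto simp: basis_graph_def\<close>)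
  then show ?thesis
    using ext indep S' card_Diff_subset[OF finite_span span_subset] by (simp add: card_V indep_def)
qed

text \<open>Modulo the span of the \<open>r - 2\<close> core vertices \<open>V\<close> becomes a plane. The \<open>q + 2\<close> other vertices of
  a daisy would span pairwise distinct lines in it, but a plane has only \<open>q + 1\<close> lines.\<close>

lemma basis_graph_daisy_free:
  assumes r: "r \<ge> 2"
  shows "\<not> contains_copy basis_graph (daisy r (q + 2))"
proof
  define J where "J = {r - 2..<r - 2 + (q + 2)}"
  have verts: "verts (daisy r (q + 2)) = {..<r - 2} \<union> J"
    by (auto simp: daisy_def J_def)
  have edge: "{..<r - 2} \<union> e \<in> edges (daisy r (q + 2))" if "e \<in> nsets J 2" for e
    using that unfolding daisy_def J_def snd_conv by blast
  assume "contains_copy basis_graph (daisy r (q + 2))"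
  then obtain f where f: "inj_on f ({..<r - 2} \<union> J)" "f ` ({..<r - 2} \<union> J) \<subseteq> verts basis_graph"
    and "\<forall>e\<in>edges (daisy r (q + 2)). f ` e \<in> edges basis_graph"
    unfolding contains_copy_def verts by blast
  then have fe: "f ` ({..<r - 2} \<union> e) \<in> edges basis_graph" if "e \<in> nsets J 2" for e
    using edge[OF that] by blast
  have fV: "f ` ({..<r - 2} \<union> J) \<subseteq> V"
    using f(2) by (auto simp: basis_graph_def)
  define C where "C = f ` {..<r - 2}"
  have C: "C \<subseteq> V"
    using fV by (auto simp: C_def)
  have fV: "f i \<in> V" "f i \<notin> C" if "i \<in> J" for i
  proof -
    show "f i \<in> V"
      using fV that by blast
    have "i \<notin> {..<r - 2}"
      using that by (auto simp: J_def)
    then show "f i \<notin> C"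
      unfolding C_def using inj_on_image_mem_iff[OF f(1), of i "{..<r - 2}"] that by blast
  qed
  \<comment> \<open>Two petals together with the core form a basis, so neither petal lies in the
    span of the core and the other.\<close>
  have indep2: "indep C" "f j \<notin> span C" "f i \<notin> span (insert (f j) C)"
    if ij: "i \<in> J" "j \<in> J" "i \<noteq> j" for i j
  proof -
    have "f ` ({..<r - 2} \<union> {i, j}) = insert (f i) (insert (f j) C)"
      by (auto simp: C_def)
    then have "indep (insert (f i) (insert (f j) C))"
      using fe[of "{i, j}"] ij by (simp add: basis_graph_def)
    moreover have "f i \<noteq> f j"
      using inj_onD[OF f(1), of i j] ij by auto
    ultimately have "indep (insert (f j) C)" "f i \<notin> span (insert (f j) C)"
      using indep_insert_iff[of "insert (f j) C" "f i"] C fV ij by auto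
    then show "indep C" "f j \<notin> span C" "f i \<notin> span (insert (f j) C)"
      using indep_insert_iff[of C "f j"] C fV ij by auto
  qed
  have other: "\<exists>i. i \<in> J \<and> i \<noteq> j" for j
  proof -
    have "r - 2 \<in> J" "Suc (r - 2) \<in> J"
      by (auto simp: J_def)
    then show ?thesis
      by (metis n_not_Suc_n)
  qed
  have indepC: "indep C" and fspan: "f j \<notin> span C" if "j \<in> J" for j
    using other[of j] indep2 that by blast+
  have J0: "r - 2 \<in> J"
    by (simp add: J_def)
  have "card C = r - 2"
    unfolding C_def using f(1) by (subst card_image) (auto intro: inj_on_subset)
  then have cardC: "card (span C) = q ^ (r - 2)"
    using indepC[OF J0] by (simp add: indep_def)
  \<comment> \<open>\<open>A j\<close> is the preimage of the nonzero points of the line through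
    \<open>f j\<close> in the quotient by \<open>span C\<close>.\<close>
  define A where "A j = span (insert (f j) C) - span C" for j
  have spC: "span C \<subseteq> span (insert (f j) C)" if "j \<in> J" for j
    using C fV(1)[OF that] by (intro span_mono) auto
  have cardA: "card (A j) = (q - 1) * q ^ (r - 2)" if "j \<in> J" for j
  proof -
    have "card (A j) = q * q ^ (r - 2) - q ^ (r - 2)"
      unfolding A_def using card_Diff_subset[OF finite_span[OF C] spC[OF that]]
        card_span_insert[OF C fV(1)[OF that] fspan[OF that]] cardC by simp
    then show ?thesis
      by (simp add: diff_mult_distrib)
  qed
  \<comment> \<open>A line is generated by any of its nonzero points: one inclusion and equal
    cardinality give equality.\<close>
  have eq: "span (insert x C) = span (insert (f j) C)" if j: "j \<in> J" and x: "x \<in> A j" for x j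
  proof (rule card_subset_eq)
    have fj: "insert (f j) C \<subseteq> V"
      using C fV(1)[OF j] by blast
    then show "finite (span (insert (f j) C))"
      by (rule finite_span)
    have xV: "x \<in> V"
      using x span_subset[OF fj] by (auto simp: A_def)
    have "insert x C \<subseteq> span (insert (f j) C)"
      using x span_superset[OF fj] by (auto simp: A_def)
    then show "span (insert x C) \<subseteq> span (insert (f j) C)"
      using span_minimal[of "insert x C" "insert (f j) C"] xV C fj by blast
    show "card (span (insert x C)) = card (span (insert (f j) C))"
      using card_span_insert[OF C] xV x fV(1)[OF j] fspan[OF j] by (simp add: A_def)
  qed
  have disj: "A i \<inter> A j = {}" if ij: "i \<in> J" "j \<in> J" "i \<noteq> j" for i j
  proof (rule ccontr)
    assume "A i \<inter> A j \<noteq> {}"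
    then have "span (insert (f i) C) = span (insert (f j) C)"
      using eq ij by blast
    moreover have "f i \<in> span (insert (f i) C)"
      using span_superset[of "insert (f i) C"] C fV(1)[OF ij(1)] by blast
    ultimately show False
      using indep2(3)[OF ij] by simp
  qed
  have AV: "A j \<subseteq> V - span C" if "j \<in> J" for j
    using span_subset[of "insert (f j) C"] C fV(1)[OF that] by (auto simp: A_def)
  \<comment> \<open>Disjoint sets \<open>A j\<close> for \<open>q + 2\<close> petals would need
    \<open>(q + 2) * (q - 1)\<close> nonzero points in a plane that has only
    \<open>q * q - 1 = (q + 1) * (q - 1)\<close>.\<close>
  have "(q + 2) * ((q - 1) * q ^ (r - 2)) = (\<Sum>j\<in>J. card (A j))"
    using cardA by (simp add: J_def)
  also have "\<dots> = card (\<Union>j\<in>J. A j)"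
  proof (rule card_UN_disjoint[symmetric])
    show "\<forall>i\<in>J. finite (A i)"
      using AV finite_V by (meson finite_Diff finite_subset)
  qed (use disj in \<open>auto simp: J_def\<close>)
  also have "\<dots> \<le> card (V - span C)"
    using AV finite_V by (intro card_mono) auto
  also have "\<dots> = q ^ r - q ^ (r - 2)"
    using card_Diff_subset[OF finite_span[OF C] span_subset[OF C]] by (simp add: card_V cardC)
  also have "q ^ r = q * q * q ^ (r - 2)"
    using r by (metis le_add_diff_inverse power2_eq_square power_add)
  finally have "(q + 2) * (q - 1) * q ^ (r - 2) \<le> (q * q - 1) * q ^ (r - 2)"
    by (simp only: diff_mult_distrib mult.assoc mult_1)
  then have "(q + 2) * (q - 1) \<le> q * q - 1"
    using q_ge_2 by simp
  \<comment> \<open>The substitution removes the truncated subtractions.\<close>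
  moreover obtain m where "q = m + 2"
    using q_ge_2 by (metis add.commute le_Suc_ex)
  ultimately show False
    by simp
qed

lemma gamma_pos_daisy_ge:
  assumes r: "r \<ge> 2"
  shows "real (q ^ r - q ^ (r - 1)) / real (q ^ r - 1) \<le> gamma_pos r (daisy r (q + 2))"
proof -
  have "r \<ge> 1"
    using r by simp
  then show ?thesis
    using gamma_pos_ge[OF r_graph_basis_graph edges_basis_graph_nonempty basis_graph_daisy_free[OF r]
        _ daisy_pair_in_edge daisy_edge_subset_verts, of "q ^ r - q ^ (r - 1)"]
      codegree_basis_graph card_verts_basis_graph by simp
qed

end

section \<open>Finite fields inside an algebraic closure\<close>

lemma (in cring) binomial_expansion:
  assumes a: "a \<in> carrier R" and b: "b \<in> carrier R"
  shows "(a \<oplus> b) [^] (n::nat) = (\<Oplus>k\<in>{..n}. [(n choose k)] \<cdot> (a [^] k \<otimes> b [^] (n - k)))"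
proof (induction n)
  case 0
  then show ?case by simp
next
  case (Suc n)
  let ?S = "\<Oplus>k\<in>{..n}. [(n choose k)] \<cdot> (a [^] k \<otimes> b [^] (n - k))"
  let ?T = "\<lambda>k. [(n choose k)] \<cdot> (a [^] k \<otimes> b [^] (Suc n - k))"
  have "?S \<otimes> b = (\<Oplus>k\<in>{..n}. ([(n choose k)] \<cdot> (a [^] k \<otimes> b [^] (n - k))) \<otimes> b)"
    using a b by (intro finsum_ldistr) auto
  also have "\<dots> = finsum R ?T {..n}"
    using a b by (intro add.finprod_cong') (auto simp: add_pow_ldistr m_assoc Suc_diff_le)
  \<comment> \<open>The added term is zero since \<open>n choose Suc n = 0\<close>; it allows the
    index shift that aligns this sum with \<open>?U\<close>.\<close>
  also have "\<dots> = finsum R ?T {..Suc n}"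
    using a b by (subst add.finprod_Suc) (auto simp: add.finprod_closed binomial_eq_0)
  also have "\<dots> = (\<Oplus>k\<in>{..n}. ?T (Suc k)) \<oplus> ?T 0"
    using a b by (subst add.finprod_Suc2) auto
  finally have Sb: "?S \<otimes> b = (\<Oplus>k\<in>{..n}. ?T (Suc k)) \<oplus> ?T 0" .
  let ?U = "\<lambda>k. [(n choose k)] \<cdot> (a [^] Suc k \<otimes> b [^] (n - k))"
  have "?S \<otimes> a = (\<Oplus>k\<in>{..n}. ([(n choose k)] \<cdot> (a [^] k \<otimes> b [^] (n - k))) \<otimes> a)"
    using a b by (intro finsum_ldistr) auto
  also have "\<dots> = finsum R ?U {..n}"
    using a b by (intro add.finprod_cong') (auto simp: add_pow_ldistr add_pow_rdistr m_ac)
  finally have Sa: "?S \<otimes> a = finsum R ?U {..n}" .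
  let ?W = "\<lambda>k. [(Suc n choose k)] \<cdot> (a [^] k \<otimes> b [^] (Suc n - k))"
  have "finsum R ?W {..Suc n} = (\<Oplus>k\<in>{..n}. ?W (Suc k)) \<oplus> ?W 0"
    using a b by (subst add.finprod_Suc2) auto
  \<comment> \<open>Pascal's rule, termwise.\<close>
  also have "(\<Oplus>k\<in>{..n}. ?W (Suc k)) = (\<Oplus>k\<in>{..n}. ?U k \<oplus> ?T (Suc k))"
    using a b by (intro add.finprod_cong') (auto simp: add.nat_pow_mult)
  also have "\<dots> = finsum R ?U {..n} \<oplus> (\<Oplus>k\<in>{..n}. ?T (Suc k))"
    using a b by (intro add.finprod_multf) auto
  also have "\<dots> \<oplus> ?W 0 = ?S \<otimes> a \<oplus> ?S \<otimes> b"
    unfolding Sa Sb using a b by (simp add: add.finprod_closed Pi_def a_assoc)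
  also have "\<dots> = ?S \<otimes> (a \<oplus> b)"
    using a b by (simp add: r_distr add.finprod_closed Pi_def)
  finally show ?case using Suc.IH by simp
qed

text \<open>For exponent \<open>p\<close> the inner binomial coefficients are multiples of
  \<open>p\<close> and vanish; powers of \<open>p\<close> follow by iteration.\<close>

lemma (in cring) frobenius_add:
  assumes p: "Factorial_Ring.prime (p::nat)" and char: "[p] \<cdot> \<one> = \<zero>"
    and a: "a \<in> carrier R" and b: "b \<in> carrier R"
  shows "(a \<oplus> b) [^] (p ^ k) = a [^] (p ^ k) \<oplus> b [^] (p ^ k)"
proof -
  have prime_step: "(x \<oplus> y) [^] p = x [^] p \<oplus> y [^] p"
    if x: "x \<in> carrier R" and y: "y \<in> carrier R" for x y
  proof -
    have zero: "[(p choose k)] \<cdot> z = \<zero>" if "z \<in> carrier R" "0 < k" "k < p" for z k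
    proof -
      have "p dvd p choose k"
        using p that by (intro dvd_choose_prime) auto
      then obtain m where "p choose k = p * m" by blast
      moreover have "[p] \<cdot> z = \<zero>"
        using add_pow_ldistr[of \<one> z p] char that by simp
      ultimately show ?thesis
        using that add.nat_pow_pow[of z m p] by (simp add: add.nat_pow_one)
    qed
    let ?T = "\<lambda>k. [(p choose k)] \<cdot> (x [^] k \<otimes> y [^] (p - k))"
    \<comment> \<open>With \<open>p = m + 2\<close> the inner indices are \<open>Suc k\<close> for
      \<open>k \<le> m\<close>, leaving the two end terms to split off.\<close>
    obtain m where m: "p = Suc (Suc m)"
      using prime_ge_2_nat[OF p] by (metis add_2_eq_Suc le_Suc_ex)
    have "(x \<oplus> y) [^] p = finsum R ?T {..Suc (Suc m)}"
      unfolding binomial_expansion[OF x y] using m by simp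
    also have "\<dots> = ?T (Suc (Suc m)) \<oplus> ((\<Oplus>k\<in>{..m}. ?T (Suc k)) \<oplus> ?T 0)"
      using x y by (subst add.finprod_Suc, simp, subst add.finprod_Suc2) auto
    also have "(\<Oplus>k\<in>{..m}. ?T (Suc k)) = (\<Oplus>k\<in>{..m}. \<zero>)"
      using x y m by (intro add.finprod_cong' zero) auto
    also have "?T (Suc (Suc m)) \<oplus> ((\<Oplus>k\<in>{..m}. \<zero>) \<oplus> ?T 0) = x [^] p \<oplus> y [^] p"
      using x y m[symmetric] by (simp add: add.nat_pow_eone)
    finally show ?thesis .
  qed
  show ?thesis
  proof (induction k)
    case 0
    then show ?case using a b by simp
  next
    case (Suc k)
    have "(a \<oplus> b) [^] (p ^ Suc k) = ((a \<oplus> b) [^] (p ^ k)) [^] p"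
      using a b by (simp add: nat_pow_pow mult.commute)
    also have "\<dots> = (a [^] (p ^ k)) [^] p \<oplus> (b [^] (p ^ k)) [^] p"
      unfolding Suc.IH using a b by (intro prime_step) auto
    finally show ?case
      using a b by (simp add: nat_pow_pow mult.commute)
  qed
qed

text \<open>At a root \<open>a\<close> Frobenius gives \<open>X^q - X = (X - a)^q - (X - a)\<close>, so all roots are simple.\<close>

lemma (in algebraically_closed) card_frobenius_fixed:
  assumes p: "Factorial_Ring.prime (p::nat)" and char: "[p] \<cdot> \<one> = \<zero>" and k: "k > 0"
  shows "card {x \<in> carrier L. x [^] (p ^ k) = x} = p ^ k"
proof -
  interpret UP: domain "poly_ring L"
    using univ_poly_is_domain[OF carrier_is_subring] .
  interpret C: ring_hom_ring L "poly_ring L" poly_of_const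
    using canonical_embedding_ring_hom[OF carrier_is_subring] by simp
  define q where "q = p ^ k"
  have q: "q > 1"
    unfolding q_def using k prime_gt_1_nat[OF p] by (intro one_less_power)
  define P where "P = X [^]\<^bsub>poly_ring L\<^esub> q \<ominus>\<^bsub>poly_ring L\<^esub> X"
  have X: "X \<in> carrier (poly_ring L)"
    using var_closed(1)[OF carrier_is_subring] .
  have P: "P \<in> carrier (poly_ring L)"
    unfolding P_def using X by simp
  have eval_P: "eval P a = a [^] q \<ominus> a" if a: "a \<in> carrier L" for a
  proof -
    interpret E: ring_hom_ring "poly_ring L" L "\<lambda>f. eval f a"
      using eval_ring_hom[OF carrier_is_subring a] .
    show ?thesis
      unfolding P_def a_minus_def using X a by (simp add: E.hom_nat_pow eval_var)
  qed
  have deg: "degree P = q"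
  proof -
    have "\<ominus>\<^bsub>poly_ring L\<^esub> X = [\<ominus> \<one>, \<zero>]"
      using univ_poly_a_inv_def'[OF carrier_is_subring X] by (simp add: var_def)
    moreover have "\<ominus>\<^bsub>poly_ring L\<^esub> X \<in> carrier (poly_ring L)"
      using X by simp
    moreover have "X [^]\<^bsub>poly_ring L\<^esub> q = monom \<one> q"
      using unitary_monom_eq_var_pow[OF carrier_is_subring] by simp
    moreover have "X [^]\<^bsub>poly_ring L\<^esub> q \<in> carrier (poly_ring L)"
      using X by simp
    ultimately show ?thesis
      unfolding P_def a_minus_def univ_poly_add
      using poly_add_degree_eq[OF carrier_is_subring, of "monom \<one> q" "[\<ominus> \<one>, \<zero>]"] q
      by (simp add: univ_poly_carrier monom_def)
  qed
  \<comment> \<open>Characteristic \<open>p\<close> passes to the polynomial ring, so that Frobenius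
    applies to polynomials.\<close>
  have charP: "[p] \<cdot>\<^bsub>poly_ring L\<^esub> \<one>\<^bsub>poly_ring L\<^esub> = \<zero>\<^bsub>poly_ring L\<^esub>"
  proof -
    have "poly_of_const ([n] \<cdot> \<one>) = [n] \<cdot>\<^bsub>poly_ring L\<^esub> \<one>\<^bsub>poly_ring L\<^esub>" for n :: nat
      by (induction n) (auto simp: C.hom_add)
    from this[of p] show ?thesis using char by simp
  qed
  have count: "count (roots P) a = 1" if "is_root P a" for a
  proof -
    have a: "a \<in> carrier L" and aq: "a [^] q = a"
      using that eval_P[of a] r_right_minus_eq[of "a [^] q" a] by (auto simp: is_root_def)
    interpret E: ring_hom_ring "poly_ring L" L "\<lambda>f. eval f a"
      using eval_ring_hom[OF carrier_is_subring a] .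
    define c where "c = poly_of_const a"
    have c: "c \<in> carrier (poly_ring L)"
      unfolding c_def using a by (rule C.hom_closed)
    define D where "D = X \<ominus>\<^bsub>poly_ring L\<^esub> c"
    have D: "D \<in> carrier (poly_ring L)"
      unfolding D_def using X c by simp
    have D_eq: "D = [\<one>, \<ominus> a]"
    proof -
      have "\<ominus>\<^bsub>poly_ring L\<^esub> c = poly_of_const (\<ominus> a)"
        unfolding c_def using a by simp
      then show ?thesis
        using a unfolding D_def a_minus_def univ_poly_add poly_of_const_def var_def by auto
    qed
    \<comment> \<open>\<open>G\<close> is the cofactor of \<open>X - a\<close> in
      \<open>P = D^q - D\<close>. Since \<open>D\<close> vanishes at \<open>a\<close> and
      \<open>q > 1\<close>, its value there is \<open>-1\<close>, so \<open>a\<close> is a simple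
      root.\<close>
    define G where "G = D [^]\<^bsub>poly_ring L\<^esub> (q - 1) \<ominus>\<^bsub>poly_ring L\<^esub> \<one>\<^bsub>poly_ring L\<^esub>"
    have G: "G \<in> carrier (poly_ring L)"
      unfolding G_def using D by simp
    have Xq: "X [^]\<^bsub>poly_ring L\<^esub> q = D [^]\<^bsub>poly_ring L\<^esub> q \<oplus>\<^bsub>poly_ring L\<^esub> c"
    proof -
      have "X = D \<oplus>\<^bsub>poly_ring L\<^esub> c"
        unfolding D_def using X c by (simp add: UP.minus_eq UP.a_assoc UP.l_neg)
      then have "X [^]\<^bsub>poly_ring L\<^esub> q
          = D [^]\<^bsub>poly_ring L\<^esub> q \<oplus>\<^bsub>poly_ring L\<^esub> c [^]\<^bsub>poly_ring L\<^esub> q"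
        unfolding q_def using UP.frobenius_add[OF p charP D c] by simp
      also have "c [^]\<^bsub>poly_ring L\<^esub> q = c"
        unfolding c_def using a aq C.hom_nat_pow[of a q] by simp
      finally show ?thesis .
    qed
    have "P = D [^]\<^bsub>poly_ring L\<^esub> q \<ominus>\<^bsub>poly_ring L\<^esub> D"
      unfolding P_def Xq unfolding D_def using X c D
      by (simp add: UP.minus_eq UP.minus_add UP.a_ac)
    also have "D [^]\<^bsub>poly_ring L\<^esub> q = D \<otimes>\<^bsub>poly_ring L\<^esub> D [^]\<^bsub>poly_ring L\<^esub> (q - 1)"
      using UP.nat_pow_Suc2[OF D, of "q - 1"] q by simp
    finally have PDG: "P = D \<otimes>\<^bsub>poly_ring L\<^esub> G"
      unfolding G_def using D by (simp add: UP.minus_eq UP.r_distr UP.r_minus)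
    have "eval D a = \<zero>"
      unfolding D_eq using a by (simp add: r_neg)
    then have "eval G a = \<ominus> \<one>"
      unfolding G_def a_minus_def using D q by (simp add: E.hom_nat_pow nat_pow_zero)
    moreover have "\<ominus> \<one> \<noteq> \<zero>"
      by (metis minus_minus minus_zero one_closed one_not_zero)
    ultimately have "eval G a \<noteq> \<zero>"
      by simp
    then have G0: "\<not> is_root G a" "G \<noteq> []"
      by (auto simp: is_root_def)
    have "roots P = add_mset a (roots G)"
      unfolding PDG D_eq using poly_mult_degree_one_monic_imp_same_roots[OF a G G0(2)] .
    moreover have "a \<notin># roots G"
      using G0 roots_mem_iff_is_root[OF G] by simp
    ultimately show ?thesis
      by (simp add: not_in_iff)
  qed
  \<comment> \<open>Over an algebraically closed field \<open>P\<close> splits, so its roots with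
    multiplicity number \<open>degree P\<close>; simplicity turns this into a count of distinct
    roots.\<close>
  have "q = size (roots P)"
    using roots_over_carrier[OF P] deg by (simp add: splitted_def)
  also have "\<dots> = card (set_mset (roots P))"
    unfolding size_multiset_overloaded_eq
    using count roots_mem_iff_is_root[OF P] by simp
  also have "set_mset (roots P) = {x \<in> carrier L. x [^] q = x}"
    using roots_mem_iff_is_root[OF P] deg q eval_P by (auto simp: is_root_def)
  finally show ?thesis
    by (simp add: q_def)
qed

text \<open>The fixed points of a ring endomorphism form a subring; inverses are fixed because the
  inverse of a fixed unit is unique.\<close>

lemma (in field) subfield_frobenius_fixed:
  assumes p: "Factorial_Ring.prime (p::nat)" and char: "[p] \<cdot> \<one> = \<zero>"
  shows "subfield {x \<in> carrier R. x [^] (p ^ k) = x} R" (is "subfield ?K R")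
proof (rule subfieldI')
  have p0: "p ^ k \<noteq> 0"
    using p by (simp add: prime_gt_0_nat)
  show "subring ?K R"
  proof (rule subringI)
    fix x y assume xy: "x \<in> ?K" "y \<in> ?K"
    then show "x \<otimes> y \<in> ?K"
      by (simp add: pow_mult_distrib m_comm)
    show "x \<oplus> y \<in> ?K"
      using xy frobenius_add[OF p char, of x y k] by simp
  next
    fix x assume x: "x \<in> ?K"
    then have "x \<oplus> (\<ominus> x) [^] (p ^ k) = (x \<oplus> \<ominus> x) [^] (p ^ k)"
      using frobenius_add[OF p char, of x "\<ominus> x" k] by simp
    also have "\<dots> = \<zero>"
      using x p0 by (simp add: r_neg nat_pow_zero)
    finally show "\<ominus> x \<in> ?K"
      using x by (simp add: a_comm sum_zero_eq_neg)
  qed auto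
  fix x assume x: "x \<in> ?K - {\<zero>}"
  then have unit: "x \<in> Units R"
    by (simp add: field_Units)
  have "x \<otimes> (inv x) [^] (p ^ k) = \<one>"
    using x unit pow_mult_distrib[of x "inv x" "p ^ k"] m_comm[of x "inv x"] by simp
  then have "inv x = (inv x) [^] (p ^ k)"
    using x unit by (intro comm_inv_char) auto
  then show "inv x \<in> ?K"
    using unit by simp
qed

section \<open>A finite field as a vector space over a subfield\<close>

text \<open>Scalars and vectors share one field, so its arithmetic supplies the vector space laws.
  The core is the insertion law: adjoining \<open>v\<close> outside \<open>U\<close> yields
  \<open>K v + U\<close> with unique representations, hence \<open>q\<close> times as many
  elements.\<close>

lemma (in field) counting_span_subfields:
  assumes K: "subfield K R" "card K = q" and V: "subfield V R" "K \<subseteq> V" "finite V" "card V = q ^ r"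
  defines "lin_subspace \<equiv> \<lambda>U. \<zero> \<in> U \<and> U \<subseteq> V \<and> (\<forall>x\<in>U. \<forall>y\<in>U. x \<oplus> y \<in> U) \<and> (\<forall>a\<in>K. \<forall>x\<in>U. a \<otimes> x \<in> U)"
  shows "counting_span V (\<lambda>S. \<Inter>{U. lin_subspace U \<and> S \<subseteq> U}) q r"
proof -
  define sp where "sp S = \<Inter>{U. lin_subspace U \<and> S \<subseteq> U}" for S
  note Kr = subringE[OF subfieldE(1)[OF K(1)]]
  note Vr = subringE[OF subfieldE(1)[OF V(1)]]
  have Kc: "a \<in> carrier R" if "a \<in> K" for a
    using that Kr(1) by blast
  have Vc: "x \<in> carrier R" if "x \<in> V" for x
    using that Vr(1) by blast
  have subV: "lin_subspace V"
    unfolding lin_subspace_def using Vr(2,6,7) V(2) by blast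
  \<comment> \<open>For \<open>S \<subseteq> V\<close> the intersected family contains
    \<open>V\<close>, so the intersection stays inside \<open>V\<close>.\<close>
  have sub_sp: "lin_subspace (sp S)" if "S \<subseteq> V" for S
    unfolding lin_subspace_def sp_def using that subV by (auto simp: lin_subspace_def)
  have sp_le: "sp S \<subseteq> U" if "lin_subspace U" "S \<subseteq> U" for S U
    unfolding sp_def using that by blast
  have le_sp: "S \<subseteq> sp S" for S
    unfolding sp_def by blast
  have q2: "q \<ge> 2"
  proof -
    have "card {\<zero>, \<one>} \<le> card K"
      using Kr(2,3) V(2,3) finite_subset by (intro card_mono) auto
    then show ?thesis
      using K(2) by simp
  qed
  have insert_card: "card (sp (insert v S)) = q * card (sp S)"
    if S: "S \<subseteq> V" and v: "v \<in> V" "v \<notin> sp S" for S v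
  proof -
    define U where "U = sp S"
    have U: "lin_subspace U"
      using sub_sp[OF S] by (simp add: U_def)
    have Uc: "x \<in> carrier R" if "x \<in> U" for x
      using that U Vc by (auto simp: lin_subspace_def)
    define E where "E = (\<lambda>(a, u). a \<otimes> v \<oplus> u) ` (K \<times> U)"
    have vc: "v \<in> carrier R"
      using v Vc by blast
    have "lin_subspace E"
      unfolding lin_subspace_def
    proof (intro conjI ballI)
      show "\<zero> \<in> E"
        unfolding E_def using Kr(2) U vc by (intro image_eqI[of _ _ "(\<zero>, \<zero>)"]) (auto simp: lin_subspace_def)
      show "E \<subseteq> V"
      proof
        fix x assume "x \<in> E"
        then obtain a u where *: "a \<in> K" "u \<in> U" "x = a \<otimes> v \<oplus> u"
          by (auto simp: E_def)
        then have "a \<in> V" "u \<in> V"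
          using V(2) U by (auto simp: lin_subspace_def)
        then show "x \<in> V"
          unfolding *(3) using v(1) by (intro Vr(6,7))
      qed
    next
      fix x y assume "x \<in> E" "y \<in> E"
      then obtain a u b w where *: "a \<in> K" "u \<in> U" "b \<in> K" "w \<in> U"
        "x = a \<otimes> v \<oplus> u" "y = b \<otimes> v \<oplus> w"
        by (auto simp: E_def)
      then have "x \<oplus> y = (a \<oplus> b) \<otimes> v \<oplus> (u \<oplus> w)"
        using Kc Uc vc by (simp add: l_distr a_ac)
      moreover have "a \<oplus> b \<in> K" "u \<oplus> w \<in> U"
        using * Kr(7) U by (auto simp: lin_subspace_def)
      ultimately show "x \<oplus> y \<in> E"
        unfolding E_def by (intro image_eqI[of _ _ "(a \<oplus> b, u \<oplus> w)"]) auto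
    next
      fix a x assume "a \<in> K" "x \<in> E"
      then obtain b u where *: "a \<in> K" "b \<in> K" "u \<in> U" "x = b \<otimes> v \<oplus> u"
        by (auto simp: E_def)
      then have "a \<otimes> x = (a \<otimes> b) \<otimes> v \<oplus> a \<otimes> u"
        using Kc Uc vc by (simp add: r_distr m_assoc)
      moreover have "a \<otimes> b \<in> K" "a \<otimes> u \<in> U"
        using * Kr(6) U by (auto simp: lin_subspace_def)
      ultimately show "a \<otimes> x \<in> E"
        unfolding E_def by (intro image_eqI[of _ _ "(a \<otimes> b, a \<otimes> u)"]) auto
    qed
    moreover have "U \<subseteq> E"
    proof
      fix u assume "u \<in> U"
      then show "u \<in> E"
        unfolding E_def using Kr(2) Uc vc by (intro image_eqI[of _ _ "(\<zero>, u)"]) auto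
    qed
    moreover have "v \<in> E"
      unfolding E_def using Kr(3) U vc by (intro image_eqI[of _ _ "(\<one>, \<zero>)"]) (auto simp: lin_subspace_def)
    ultimately have 1: "sp (insert v S) \<subseteq> E"
      using le_sp[of S] by (intro sp_le) (auto simp: U_def)
    have ins: "lin_subspace (sp (insert v S))"
      using S v by (intro sub_sp) auto
    have "U \<subseteq> sp (insert v S)"
      unfolding U_def using le_sp[of "insert v S"] by (intro sp_le[OF ins]) blast
    moreover have "v \<in> sp (insert v S)"
      using le_sp[of "insert v S"] by blast
    ultimately have "E \<subseteq> sp (insert v S)"
      using ins by (auto simp: E_def lin_subspace_def)
    with 1 have "sp (insert v S) = E"
      by blast
    moreover have "inj_on (\<lambda>(a, u). a \<otimes> v \<oplus> u) (K \<times> U)"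
    proof (intro inj_onI, clarify)
      fix a u b w
      assume *: "a \<in> K" "u \<in> U" "b \<in> K" "w \<in> U" and eq: "a \<otimes> v \<oplus> u = b \<otimes> v \<oplus> w"
      have c: "a \<in> carrier R" "b \<in> carrier R" "u \<in> carrier R" "w \<in> carrier R"
        using * Kc Uc by auto
      \<comment> \<open>If \<open>a\<close> and \<open>b\<close> differed, dividing
        \<open>(a - b) v = w - u\<close> by the nonzero scalar would put \<open>v\<close> into
        \<open>U\<close>.\<close>
      have ab: "a = b"
      proof (rule ccontr)
        assume "a \<noteq> b"
        define d where "d = a \<ominus> b"
        have d: "d \<in> K - {\<zero>}"
          unfolding d_def using * Kr(5,7) c \<open>a \<noteq> b\<close> by (auto simp: minus_eq)
            (metis c(1,2) minus_eq r_right_minus_eq)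
        have neg: "\<ominus> u \<in> U"
        proof -
          have "\<ominus> \<one> \<otimes> u \<in> U"
            using Kr(3,5) U * by (auto simp: lin_subspace_def)
          then show ?thesis
            using c by (simp add: l_minus)
        qed
        have "d \<otimes> v = a \<otimes> v \<ominus> b \<otimes> v"
          unfolding d_def using c vc by (simp add: minus_eq l_distr l_minus)
        also have "\<dots> = w \<oplus> \<ominus> u"
        proof -
          have "a \<otimes> v = b \<otimes> v \<oplus> w \<oplus> \<ominus> u"
            using eq[symmetric] c vc by (simp add: a_assoc r_neg)
          then show ?thesis
            using c vc by (simp add: minus_eq a_ac r_neg r_neg1 r_neg2)
        qed
        finally have "d \<otimes> v \<in> U"
          using U * neg by (simp add: lin_subspace_def)
        moreover have "inv d \<in> K" "inv d \<otimes> d = \<one>"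
          using subfield_m_inv[OF K(1) d] by auto
        ultimately have "inv d \<otimes> (d \<otimes> v) \<in> U"
          using U by (simp add: lin_subspace_def)
        moreover have "inv d \<otimes> (d \<otimes> v) = v"
          using \<open>inv d \<in> K\<close> \<open>inv d \<otimes> d = \<one>\<close> d Kc vc by (simp add: m_assoc[symmetric])
        ultimately show False
          using v by (simp add: U_def)
      qed
      with eq show "a = b \<and> u = w"
        using c vc by simp
    qed
    ultimately show ?thesis
      using K(2) by (simp add: E_def card_image card_cartesian_product U_def)
  qed
  have empty: "sp {} = {\<zero>}"
  proof
    have "lin_subspace {\<zero>}"
      using Vr(2) Kc by (auto simp: lin_subspace_def)
    then show "sp {} \<subseteq> {\<zero>}"
      by (rule sp_le) simp
    show "{\<zero>} \<subseteq> sp {}"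
      using sub_sp[of "{}"] by (simp add: lin_subspace_def)
  qed
  have "counting_span V sp q r"
  proof
    show "sp S \<subseteq> V" if "S \<subseteq> V" for S
      using sub_sp[OF that] by (simp add: lin_subspace_def)
    show "sp S \<subseteq> sp T" if "S \<subseteq> V" "T \<subseteq> V" "S \<subseteq> sp T" for S T
      using that by (intro sp_le sub_sp)
  qed (use q2 V le_sp empty insert_card in auto)
  then show ?thesis
    by (simp add: sp_def[abs_def])
qed

text \<open>The type is that of elements of the algebraic closure of
  \<open>residue_ring (int p)\<close>, and is the same for every \<open>p\<close>.\<close>

lemma ex_counting_span:
  assumes p: "Factorial_Ring.prime (p::nat)" and k: "k > 0" and r: "r > 0"
  shows "\<exists>(V :: ((int list \<times> nat) multiset \<Rightarrow> int) set) span. counting_span V span (p ^ k) r"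
proof -
  interpret F: residues_prime p "residue_ring (int p)"
    by unfold_locales (use p in auto)
  define L where "L = F.alg_closure"
  interpret L: algebraic_closure L "F.indexed_const ` carrier (residue_ring (int p))"
    unfolding L_def by (rule F.alg_closureE(1))
  interpret h: ring_hom_ring "residue_ring (int p)" L F.indexed_const
    using F.alg_closureE(2) F.ring_axioms L.ring_axioms
    by (auto simp: L_def intro: ring_hom_ringI2)
  \<comment> \<open>In the prime field \<open>n\<close> times one is \<open>n mod p\<close>; the
    embedding carries this into the closure.\<close>
  have char: "[p] \<cdot>\<^bsub>L\<^esub> \<one>\<^bsub>L\<^esub> = \<zero>\<^bsub>L\<^esub>"
  proof -
    have h_mult: "F.indexed_const ([n] \<cdot>\<^bsub>residue_ring (int p)\<^esub> \<one>\<^bsub>residue_ring (int p)\<^esub>) = [n] \<cdot>\<^bsub>L\<^esub> \<one>\<^bsub>L\<^esub>"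
      for n :: nat
      by (induction n) auto
    have "[n] \<cdot>\<^bsub>residue_ring (int p)\<^esub> \<one>\<^bsub>residue_ring (int p)\<^esub> = int n mod int p" for n :: nat
      by (induction n) (auto simp: F.res_zero_eq F.res_one_eq F.res_add_eq mod_simps add.commute)
    from this[of p] h_mult[of p] show ?thesis
      by (simp add: F.res_zero_eq[symmetric])
  qed
  define K where "K = {x \<in> carrier L. x [^]\<^bsub>L\<^esub> (p ^ k) = x}"
  define V where "V = {x \<in> carrier L. x [^]\<^bsub>L\<^esub> (p ^ (k * r)) = x}"
  have cards: "card K = p ^ k" "card V = (p ^ k) ^ r"
    using L.card_frobenius_fixed[OF p char, of k] L.card_frobenius_fixed[OF p char, of "k * r"] k r
    by (simp_all only: K_def V_def power_mult[symmetric] mult_pos_pos)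
  \<comment> \<open>An infinite set has \<open>card\<close> zero, so a positive cardinality gives
    finiteness.\<close>
  moreover have "finite V"
    using cards(2) p by (intro card_ge_0_finite) (simp add: prime_gt_0_nat)
  moreover have "subfield K L" "subfield V L"
    unfolding K_def V_def by (rule L.subfield_frobenius_fixed[OF p char])+
  moreover have "K \<subseteq> V"
  proof
    fix x assume "x \<in> K"
    then have x: "x \<in> carrier L" "x [^]\<^bsub>L\<^esub> (p ^ k) = x"
      by (auto simp: K_def)
    \<comment> \<open>Iterating a map that fixes \<open>x\<close> fixes \<open>x\<close>; the case
      \<open>m = r\<close> puts \<open>x\<close> into \<open>V\<close>.\<close>
    have "x [^]\<^bsub>L\<^esub> ((p ^ k) ^ m) = x" for m
    proof (induction m)
      case (Suc m)
      have "x [^]\<^bsub>L\<^esub> ((p ^ k) ^ Suc m) = (x [^]\<^bsub>L\<^esub> (p ^ k)) [^]\<^bsub>L\<^esub> ((p ^ k) ^ m)"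
        unfolding L.nat_pow_pow[OF x(1)] power_Suc ..
      also have "\<dots> = x"
        unfolding x(2) by (rule Suc)
      finally show ?case .
    qed (use x in simp)
    then show "x \<in> V"
      using x by (simp add: V_def power_mult)
  qed
  ultimately show ?thesis
    using L.counting_span_subfields[of K "p ^ k" V r] by blast
qed

section \<open>The lower bound\<close>

lemma ratio_expansion_bigo:
  fixes r :: nat
  assumes r: "r \<ge> 3"
  shows "(\<lambda>t::nat. ((real t - 1) ^ r - (real t - 1) ^ (r - 1)) / ((real t - 1) ^ r - 1)
              - (1 - 1 / real t - 1 / real t ^ 2))
           \<in> O(\<lambda>t. 1 / real t ^ 3)"
proof (rule bigoI)
  show "\<forall>\<^sub>F t in sequentially. norm (((real t - 1) ^ r - (real t - 1) ^ (r - 1)) / ((real t - 1) ^ r - 1)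
              - (1 - 1 / real t - 1 / real t ^ 2)) \<le> 20 * norm (1 / real t ^ 3)"
  proof (rule eventually_sequentiallyI[of 3])
    fix t :: nat assume t: "t \<ge> 3"
    define u where "u = real t - 1"
    have u: "u \<ge> 2" "real t = u + 1"
      using t by (auto simp: u_def)
    have "u ^ 3 \<ge> 2 ^ 3"
      using u by (intro power_mono) auto
    moreover have ur: "u ^ r \<ge> u ^ 3"
      using u r by (intro power_increasing) auto
    ultimately have u3: "u ^ 3 \<ge> 8" "u ^ r \<ge> 8"
      by auto
    have urs: "u ^ r = u * u ^ (r - 1)"
      using r by (simp flip: power_Suc)
    \<comment> \<open>With \<open>u = t - 1\<close>, the ratio is
      \<open>(1 - 1/u) (1 + 1/(u^r - 1))\<close> and \<open>1/u = 1/t + 1/t^2 + 1/(t^2 u)\<close>;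
      \<open>A\<close> and \<open>B\<close> are the two error terms, each at most
      \<open>10 / t^3\<close>.\<close>
    define A where "A = (1 - 1 / u) / (u ^ r - 1)"
    define B where "B = 1 / (real t ^ 2 * u)"
    have diff: "(u ^ r - u ^ (r - 1)) / (u ^ r - 1) - (1 - 1 / real t - 1 / real t ^ 2) = A - B"
    proof -
      have "(u ^ r - u ^ (r - 1)) / (u ^ r - 1) = (1 - 1 / u) + A"
        using u u3 by (simp add: A_def field_simps urs)
      moreover have "1 - 1 / u - (1 - 1 / real t - 1 / real t ^ 2) = - B"
      proof -
        have "u \<noteq> 0" "real t \<noteq> 0"
          using u by auto
        then show ?thesis
          unfolding B_def by (simp add: divide_simps) (simp add: u(2) algebra_simps power2_eq_square)
      qed
      ultimately show ?thesis by linarith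
    qed
    have "A \<le> 1 / (u ^ r - 1)" "0 \<le> A"
      unfolding A_def using u u3 by (auto intro!: divide_right_mono)
    moreover have "1 / (u ^ r - 1) \<le> 10 * (1 / real t ^ 3)"
    proof -
      \<comment> \<open>From \<open>u \<ge> 2\<close> follows
        \<open>t = u + 1 \<le> 3/2 u\<close>.\<close>
      have "real t ^ 3 \<le> (3 / 2 * u) ^ 3"
        using u by (intro power_mono) auto
      also have "\<dots> = 27 / 8 * u ^ 3"
        by (simp add: power_mult_distrib power3_eq_cube)
      also have "\<dots> \<le> 10 * (u ^ r - 1)"
      proof -
        have "27 * u ^ 3 \<le> 80 * (u ^ r - 1)"
          using ur u3 by argo
        then show ?thesis by simp
      qed
      finally show ?thesis
        using u u3 by (simp add: divide_simps)
    qed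
    moreover have "B \<le> 10 * (1 / real t ^ 3)" "0 \<le> B"
    proof -
      have "real t ^ 3 = real t ^ 2 * real t"
        by (simp add: power3_eq_cube power2_eq_square)
      also have "\<dots> \<le> real t ^ 2 * (10 * u)"
        using u by (intro mult_left_mono) auto
      finally show "B \<le> 10 * (1 / real t ^ 3)"
        unfolding B_def using u by (simp add: divide_simps mult_ac)
      show "0 \<le> B"
        unfolding B_def using u by simp
    qed
    ultimately have "\<bar>A - B\<bar> \<le> 20 * (1 / real t ^ 3)"
      by linarith
    then show "norm (((real t - 1) ^ r - (real t - 1) ^ (r - 1)) / ((real t - 1) ^ r - 1)
              - (1 - 1 / real t - 1 / real t ^ 2)) \<le> 20 * norm (1 / real t ^ 3)"
      unfolding u_def[symmetric] diff real_norm_def by simp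
  qed
qed

theorem theorem1p4:
  fixes r :: nat
  assumes "r \<ge> 3"
  shows "(\<forall>t::nat. t \<ge> 3 \<longrightarrow> primepow (t - 1) \<longrightarrow>
            gamma_pos r (daisy r (t + 1))
              \<ge> ((real t - 1) ^ r - (real t - 1) ^ (r - 1)) / ((real t - 1) ^ r - 1))
       \<and> (\<lambda>t::nat. ((real t - 1) ^ r - (real t - 1) ^ (r - 1)) / ((real t - 1) ^ r - 1)
              - (1 - 1 / real t - 1 / real t ^ 2))
           \<in> O(\<lambda>t. 1 / real t ^ 3)"
proof (intro conjI allI impI)
  fix t :: nat assume t: "t \<ge> 3" and pp: "primepow (t - 1)"
  define q where "q = t - 1"
  obtain p k where "Factorial_Ring.prime p" "k > 0" "q = p ^ k"
    using pp by (auto simp: primepow_def q_def)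
  then obtain V :: "((int list \<times> nat) multiset \<Rightarrow> int) set" and span where "counting_span V span q r"
    using ex_counting_span[of p k r] assms by auto
  then interpret counting_span V span q r .
  \<comment> \<open>This makes the natural-number subtractions exact, so they pass to the
    reals.\<close>
  have "q \<ge> 1"
    using t by (simp add: q_def)
  then have "real (q ^ r - q ^ (r - 1)) = real q ^ r - real q ^ (r - 1)" "real (q ^ r - 1) = real q ^ r - 1"
    by (auto simp: of_nat_diff power_increasing)
  moreover have "real q = real t - 1" "q + 2 = t + 1"
    using t by (auto simp: q_def)
  ultimately show "gamma_pos r (daisy r (t + 1))
      \<ge> ((real t - 1) ^ r - (real t - 1) ^ (r - 1)) / ((real t - 1) ^ r - 1)"
    using gamma_pos_daisy_ge assms by simp
qed (rule ratio_expansion_bigo[OF assms])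

end
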